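(* Let $1\le p\le\infty$, let $X,Y$ be Banach spaces, and let $Z\supseteq X$ be a Banach space with $\dim(Z/X)<\infty$. (i) If $T\in K_p(X,Y)$, then there exists a Banach space $V\supseteq Y$ such that $T$ (viewed as an operator into $V$) admits a $p$-compact extension $\widetilde T:Z\to V$. (ii) If $T\in W_p(X,Y)$, then there exists a Banach space $V\supseteq Y$ such that $T$ (viewed as an operator into $V$) admits a weakly $p$-compact extension $\widetilde T:Z\to V$.
   Context: Banach spaces are over the complex scalars; $B(X,Y)$ is the space of bounded linear operators and $B_X$ the closed unit ball. For $1\le p\le\infty$ let $\frac1p+\frac1q=1$, with $c_0$ used in place of $\ell_q$ when $p=1$. For $p<\infty$: $\ell_p^s(Y)$ is the space of sequences $(y_n)$ in $Y$ with $\sum_n\|y_n\|^p<\infty$, and $\ell_p^w(Y)$ the space of sequences with $\sum_n|y^*(y_n)|^p<\infty$ for all $y^*\in Y^*$. For $p=\infty$ these are replaced by $c_0^s(Y)$ (norm-null sequences) and $c_0^w(Y)$ (weakly null sequences). $E_y:\ell_q\to Y$ is $E_y((\alpha_n))=\sum_n\alpha_ny_n$. $T\in B(X,Y)$ is $p$-compact (resp. weakly $p$-compact) if $T(B_X)\subseteq E_y(B_{\ell_q})$ for some $y\in\ell_p^s(Y)$ (resp. $\ell_p^w(Y)$), with the replacements above if $p=\infty$; $K_p(X,Y)$ and $W_p(X,Y)$ denote the sets of $p$-compact and weakly $p$-compact operators. *)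

theory Defs
  imports "HOL-Analysis.Analysis" "HOL-Library.Function_Algebras"
begin

section \<open>Complex vector spaces\<close>

class complex_vector = ab_group_add +
  fixes scaleC :: "complex \<Rightarrow> 'a \<Rightarrow> 'a" (infixr "*\<^sub>C" 75)
  assumes scaleC_add_right: "a *\<^sub>C (x + y) = a *\<^sub>C x + a *\<^sub>C y"
    and scaleC_add_left: "(a + b) *\<^sub>C x = a *\<^sub>C x + b *\<^sub>C x"
    and scaleC_scaleC: "a *\<^sub>C (b *\<^sub>C x) = (a * b) *\<^sub>C x"
    and scaleC_one: "1 *\<^sub>C x = x"

global_interpretation cvec: vector_space "scaleC :: complex \<Rightarrow> 'a \<Rightarrow> 'a::complex_vector"
  by standard (simp_all add: scaleC_add_right scaleC_add_left scaleC_scaleC scaleC_one)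

instantiation complex :: complex_vector
begin
definition scaleC_complex_def: "a *\<^sub>C (z::complex) = a * z"
instance by standard (simp_all add: scaleC_complex_def algebra_simps)
end

instantiation prod :: (complex_vector, complex_vector) complex_vector
begin
definition scaleC_prod_def: "a *\<^sub>C z = (a *\<^sub>C fst z, a *\<^sub>C snd z)"
instance
  by standard
    (simp_all add: scaleC_prod_def scaleC_add_right scaleC_add_left scaleC_scaleC scaleC_one)
end

instantiation "fun" :: (type, complex_vector) complex_vector
begin
definition scaleC_fun_def: "a *\<^sub>C f = (\<lambda>x. a *\<^sub>C f x)"
instance
  by standard
    (simp_all add: scaleC_fun_def fun_eq_iff scaleC_add_right scaleC_add_left scaleC_scaleC
      scaleC_one)
end

section \<open>Banach spaces with explicit carrier and norm\<close>

text \<open>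
  An existential quantifier over Banach spaces cannot range over types.  A Banach space is
  therefore a linear subspace of an ambient complex vector space (a type that carries no norm)
  together with its own norm on that subspace.  Values of the norm, and of operators, outside
  the carrier are irrelevant.
\<close>

record 'a nspace =
  carr :: "'a set"
  nrm :: "'a \<Rightarrow> real"

definition normed_space :: "'a::complex_vector nspace \<Rightarrow> bool" where
  "normed_space X \<longleftrightarrow>
     cvec.subspace (carr X) \<and>
     (\<forall>x\<in>carr X. 0 \<le> nrm X x \<and> (nrm X x = 0 \<longleftrightarrow> x = 0)) \<and>
     (\<forall>x\<in>carr X. \<forall>y\<in>carr X. nrm X (x + y) \<le> nrm X x + nrm X y) \<and>
     (\<forall>c. \<forall>x\<in>carr X. nrm X (c *\<^sub>C x) = cmod c * nrm X x)"

definition norm_limit :: "'a::complex_vector nspace \<Rightarrow> (nat \<Rightarrow> 'a) \<Rightarrow> 'a \<Rightarrow> bool" where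
  "norm_limit X s l \<longleftrightarrow> l \<in> carr X \<and> (\<lambda>n. nrm X (s n - l)) \<longlonglongrightarrow> 0"

definition norm_Cauchy :: "'a::complex_vector nspace \<Rightarrow> (nat \<Rightarrow> 'a) \<Rightarrow> bool" where
  "norm_Cauchy X s \<longleftrightarrow> (\<forall>e>0. \<exists>M. \<forall>m\<ge>M. \<forall>n\<ge>M. nrm X (s m - s n) < e)"

definition banach_space :: "'a::complex_vector nspace \<Rightarrow> bool" where
  "banach_space X \<longleftrightarrow> normed_space X \<and>
     (\<forall>s. (\<forall>n. s n \<in> carr X) \<and> norm_Cauchy X s \<longrightarrow> (\<exists>l. norm_limit X s l))"

definition closed_unit_ball :: "'a nspace \<Rightarrow> 'a set" where
  "closed_unit_ball X = {x \<in> carr X. nrm X x \<le> 1}"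

definition normed_subspace :: "'a nspace \<Rightarrow> 'a nspace \<Rightarrow> bool" where
  "normed_subspace X Z \<longleftrightarrow> carr X \<subseteq> carr Z \<and> (\<forall>x\<in>carr X. nrm X x = nrm Z x)"

definition quot_coset :: "'a::complex_vector nspace \<Rightarrow> 'a \<Rightarrow> 'a set" where
  "quot_coset X z = (\<lambda>x. z + x) ` carr X"

definition quot_space :: "'a::complex_vector nspace \<Rightarrow> 'a nspace \<Rightarrow> 'a set set" where
  "quot_space Z X = quot_coset X ` carr Z"

text \<open>
  Linear combinations in \<open>Z/X\<close> are computed on representatives, so the following says that
  \<open>Z/X\<close> is spanned by the cosets of finitely many elements of \<open>Z\<close>.
\<close>

definition finite_dim_quot :: "'a::complex_vector nspace \<Rightarrow> 'a nspace \<Rightarrow> bool" where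
  "finite_dim_quot Z X \<longleftrightarrow>
     (\<exists>F. finite F \<and> F \<subseteq> carr Z \<and>
        (\<forall>Q\<in>quot_space Z X. \<exists>c. Q = quot_coset X (\<Sum>f\<in>F. c f *\<^sub>C f)))"

section \<open>Bounded operators\<close>

definition bounded_ops ::
  "'a::complex_vector nspace \<Rightarrow> 'b::complex_vector nspace \<Rightarrow> ('a \<Rightarrow> 'b) set" where
  "bounded_ops X Y = {T.
     (\<forall>x\<in>carr X. T x \<in> carr Y) \<and>
     (\<forall>x\<in>carr X. \<forall>y\<in>carr X. T (x + y) = T x + T y) \<and>
     (\<forall>c. \<forall>x\<in>carr X. T (c *\<^sub>C x) = c *\<^sub>C T x) \<and>
     (\<exists>C. \<forall>x\<in>carr X. nrm Y (T x) \<le> C * nrm X x)}"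

definition scalar_space :: "complex nspace" where
  "scalar_space = \<lparr>carr = UNIV, nrm = cmod\<rparr>"

definition dual :: "'a::complex_vector nspace \<Rightarrow> ('a \<Rightarrow> complex) set" where
  "dual X = bounded_ops X scalar_space"

definition isometric_embedding ::
  "('a::complex_vector \<Rightarrow> 'b::complex_vector) \<Rightarrow> 'a nspace \<Rightarrow> 'b nspace \<Rightarrow> bool" where
  "isometric_embedding j Y V \<longleftrightarrow>
     j \<in> bounded_ops Y V \<and> (\<forall>y\<in>carr Y. nrm V (j y) = nrm Y y)"

text \<open>
  The ambient type in which superspaces \<open>V\<close> of \<open>Y\<close> are sought.  It only has to be large enough
  algebraically, since the norm of \<open>V\<close> is unrelated to it: given \<open>V\<close>, a weakly \<open>p\<close>-compact
  \<open>S : Z \<rightarrow> V\<close> extending \<open>T : X \<rightarrow> Y\<close>, and a sequence witnessing this, \<open>V\<close> can be replaced by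
  the closed span \<open>W\<close> of \<open>Y\<close>, \<open>S(Z)\<close> and the sequence.  As \<open>Z/X\<close> is finite-dimensional,
  \<open>Y + S(Z)\<close> is closed with separable quotient \<open>W/(Y + S(Z))\<close>, whose algebraic dimension is at
  most that of \<open>nat \<Rightarrow> complex\<close>.  So \<open>W\<close> is linearly isomorphic to a subspace of this type.
\<close>

type_synonym ('b, 'c) superspace_type = "'b \<times> 'c \<times> (nat \<Rightarrow> complex)"

section \<open>Sequence spaces\<close>

definition conj_exp :: "ereal \<Rightarrow> ereal" where
  "conj_exp p = 1 / (1 - 1 / p)"

lemma conj_exp_conjugate:
  assumes "1 \<le> p"
  shows "1 / p + 1 / conj_exp p = 1"
proof (cases p)
  case (real r)
  with assms have r: "1 \<le> r" by simp
  show ?thesis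
  proof (cases "r = 1")
    case True
    then show ?thesis
      using real by (simp add: conj_exp_def divide_ereal_def flip: one_ereal_def zero_ereal_def)
  next
    case False
    with r have "1 < r" by simp
    then show ?thesis
      using real
      by (simp add: conj_exp_def one_ereal_def zero_ereal_def divide_simps)
  qed
qed (use assms in \<open>auto simp: conj_exp_def\<close>)

definition c0_space :: "(nat \<Rightarrow> complex) nspace" where
  "c0_space = \<lparr>carr = {a. a \<longlonglongrightarrow> 0}, nrm = (\<lambda>a. SUP n. cmod (a n))\<rparr>"

definition lq_space :: "real \<Rightarrow> (nat \<Rightarrow> complex) nspace" where
  "lq_space q = \<lparr>carr = {a. summable (\<lambda>n. cmod (a n) powr q)},
                 nrm = (\<lambda>a. (\<Sum>n. cmod (a n) powr q) powr (1 / q))\<rparr>"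

text \<open>
  The domain of the operators \<open>E\<^sub>y\<close> for the exponent \<open>p\<close>; the conjugate exponent is a real
  number unless \<open>p = 1\<close>.
\<close>

definition coeff_space :: "ereal \<Rightarrow> (nat \<Rightarrow> complex) nspace" where
  "coeff_space p = (if p = 1 then c0_space else lq_space (real_of_ereal (conj_exp p)))"

definition lp_strong :: "ereal \<Rightarrow> 'a::complex_vector nspace \<Rightarrow> (nat \<Rightarrow> 'a) set" where
  "lp_strong p Y = {y. (\<forall>n. y n \<in> carr Y) \<and>
     (if p = \<infinity> then (\<lambda>n. nrm Y (y n)) \<longlonglongrightarrow> 0
      else summable (\<lambda>n. nrm Y (y n) powr real_of_ereal p))}"

definition lp_weak :: "ereal \<Rightarrow> 'a::complex_vector nspace \<Rightarrow> (nat \<Rightarrow> 'a) set" where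
  "lp_weak p Y = {y. (\<forall>n. y n \<in> carr Y) \<and>
     (\<forall>f\<in>dual Y.
        if p = \<infinity> then (\<lambda>n. f (y n)) \<longlonglongrightarrow> 0
        else summable (\<lambda>n. cmod (f (y n)) powr real_of_ereal p))}"

text \<open>
  \<open>E_rel Y y a v\<close> is the graph of \<open>E\<^sub>y\<close>: the series of the \<open>a n *\<^sub>C y n\<close> converges in norm
  to \<open>v\<close>.
\<close>

definition E_rel ::
  "'a::complex_vector nspace \<Rightarrow> (nat \<Rightarrow> 'a) \<Rightarrow> (nat \<Rightarrow> complex) \<Rightarrow> 'a \<Rightarrow> bool" where
  "E_rel Y y a v \<longleftrightarrow> norm_limit Y (\<lambda>N. \<Sum>n<N. a n *\<^sub>C y n) v"

definition E_image ::
  "'a::complex_vector nspace \<Rightarrow> (nat \<Rightarrow> 'a) \<Rightarrow> (nat \<Rightarrow> complex) set \<Rightarrow> 'a set" where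
  "E_image Y y A = {v. \<exists>a\<in>A. E_rel Y y a v}"

section \<open>Compactness of operators relative to an exponent\<close>

definition p_compact_ops ::
  "ereal \<Rightarrow> 'a::complex_vector nspace \<Rightarrow> 'b::complex_vector nspace \<Rightarrow> ('a \<Rightarrow> 'b) set" where
  "p_compact_ops p X Y = {T \<in> bounded_ops X Y.
     \<exists>y\<in>lp_strong p Y. T ` closed_unit_ball X \<subseteq> E_image Y y (closed_unit_ball (coeff_space p))}"

definition weakly_p_compact_ops ::
  "ereal \<Rightarrow> 'a::complex_vector nspace \<Rightarrow> 'b::complex_vector nspace \<Rightarrow> ('a \<Rightarrow> 'b) set" where
  "weakly_p_compact_ops p X Y = {T \<in> bounded_ops X Y.
     \<exists>y\<in>lp_weak p Y. T ` closed_unit_ball X \<subseteq> E_image Y y (closed_unit_ball (coeff_space p))}"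

text \<open>
  \<open>S\<close> extends \<open>T\<close>, viewed as an operator into the superspace \<open>V\<close> of \<open>Y\<close> via the isometric
  embedding \<open>j\<close>.
\<close>

definition extends_via ::
  "('c \<Rightarrow> 'v) \<Rightarrow> ('b \<Rightarrow> 'v) \<Rightarrow> ('c \<Rightarrow> 'b) \<Rightarrow> 'c nspace \<Rightarrow> bool" where
  "extends_via S j T X \<longleftrightarrow> (\<forall>x\<in>carr X. S x = j (T x))"

end

(* The superspace V can be taken to be (a copy of) Y itself: X is complete, hence closed, and of
   finite codimension in Z, so it is the range of a bounded projection P of Z.  The operator T o P
   extends T, and it inherits (weak) p-compactness because P maps the unit ball of Z into a
   multiple of the unit ball of X. *)

theory Submission
  imports Defs
begin

section \<open>Norm estimates and bounded operators relative to carriers\<close>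

section \<open>Normed spaces and bounded operators\<close>

lemma normed_spaceD:
  assumes "normed_space X"
  shows "cvec.subspace (carr X)"
    and "x \<in> carr X \<Longrightarrow> 0 \<le> nrm X x"
    and "x \<in> carr X \<Longrightarrow> nrm X x = 0 \<longleftrightarrow> x = 0"
    and "x \<in> carr X \<Longrightarrow> y \<in> carr X \<Longrightarrow> nrm X (x + y) \<le> nrm X x + nrm X y"
    and "x \<in> carr X \<Longrightarrow> nrm X (c *\<^sub>C x) = cmod c * nrm X x"
  using assms unfolding normed_space_def by blast+

lemma normed_space_carr:
  assumes "normed_space X"
  shows "0 \<in> carr X"
    and "x \<in> carr X \<Longrightarrow> y \<in> carr X \<Longrightarrow> x + y \<in> carr X"
    and "x \<in> carr X \<Longrightarrow> y \<in> carr X \<Longrightarrow> x - y \<in> carr X"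
    and "x \<in> carr X \<Longrightarrow> c *\<^sub>C x \<in> carr X"
  using normed_spaceD(1)[OF assms]
  by (simp_all add: cvec.subspace_0 cvec.subspace_add cvec.subspace_diff cvec.subspace_scale)

lemma nrm_minus_commute:
  assumes "normed_space X" "x \<in> carr X" "y \<in> carr X"
  shows "nrm X (x - y) = nrm X (y - x)"
  using normed_spaceD(5)[OF assms(1), of "x - y" "-1"] normed_space_carr(3)[OF assms]
  by (simp add: cvec.scale_minus_left)

lemma nrm_diff_triangle:
  assumes "normed_space X" "x \<in> carr X" "y \<in> carr X" "z \<in> carr X"
  shows "nrm X (x - z) \<le> nrm X (x - y) + nrm X (y - z)"
  using normed_spaceD(4)[OF assms(1), of "x - y" "y - z"] normed_space_carr(3)[OF assms(1)] assms
  by simp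

lemma nrm_diff_le:
  assumes "normed_space X" "x \<in> carr X" "y \<in> carr X"
  shows "nrm X (x - y) \<le> nrm X x + nrm X y"
  using nrm_diff_triangle[OF assms(1,2) normed_space_carr(1)[OF assms(1)] assms(3)]
    nrm_minus_commute[OF assms(1) normed_space_carr(1)[OF assms(1)] assms(3)]
  by simp

lemma normed_space_subspace:
  assumes "normed_space Z" "normed_subspace X Z" "cvec.subspace (carr X)"
  shows "normed_space X"
  using assms unfolding normed_space_def normed_subspace_def
  by (simp add: subset_iff cvec.subspace_add cvec.subspace_scale)

lemma bounded_opsD:
  assumes "T \<in> bounded_ops X Y"
  shows "x \<in> carr X \<Longrightarrow> T x \<in> carr Y"
    and "x \<in> carr X \<Longrightarrow> y \<in> carr X \<Longrightarrow> T (x + y) = T x + T y"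
    and "x \<in> carr X \<Longrightarrow> T (c *\<^sub>C x) = c *\<^sub>C T x"
  using assms unfolding bounded_ops_def by blast+

text \<open>The constant in \<open>bounded_ops\<close> is an arbitrary real number. Replacing it by
  its maximum with 1 gives a strictly positive one, so that later arguments can divide by
  it.\<close>

lemma bounded_ops_bound:
  assumes "normed_space X" "T \<in> bounded_ops X Y"
  obtains C where "C > 0" "\<And>x. x \<in> carr X \<Longrightarrow> nrm Y (T x) \<le> C * nrm X x"
proof -
  obtain C where C: "\<And>x. x \<in> carr X \<Longrightarrow> nrm Y (T x) \<le> C * nrm X x"
    using assms(2) unfolding bounded_ops_def by blast
  show ?thesis
  proof (rule that[of "max C 1"])
    fix x assume x: "x \<in> carr X"
    show "nrm Y (T x) \<le> max C 1 * nrm X x"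
      by (rule order_trans[OF C[OF x] mult_right_mono]) (simp_all add: normed_spaceD(2)[OF assms(1) x])
  qed simp
qed

lemma bounded_ops_comp:
  assumes "normed_space X" "normed_space Y" "T \<in> bounded_ops X Y" "U \<in> bounded_ops Y V"
  shows "(\<lambda>x. U (T x)) \<in> bounded_ops X V"
proof -
  obtain C where C: "C > 0" "\<And>x. x \<in> carr X \<Longrightarrow> nrm Y (T x) \<le> C * nrm X x"
    using bounded_ops_bound[OF assms(1,3)] by blast
  obtain D where D: "D > 0" "\<And>x. x \<in> carr Y \<Longrightarrow> nrm V (U x) \<le> D * nrm Y x"
    using bounded_ops_bound[OF assms(2,4)] by blast
  have "nrm V (U (T x)) \<le> (D * C) * nrm X x" if "x \<in> carr X" for x
  proof -
    have "nrm V (U (T x)) \<le> D * nrm Y (T x)"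
      using D(2) bounded_opsD(1)[OF assms(3) that] by blast
    also have "\<dots> \<le> D * (C * nrm X x)"
      using C(2)[OF that] D(1) by simp
    finally show ?thesis by (simp add: mult.assoc)
  qed
  then show ?thesis
    using bounded_opsD[OF assms(3)] bounded_opsD[OF assms(4)] unfolding bounded_ops_def by auto
qed

text \<open>Serves in \<open>E_image_comp\<close> to absorb the bound of a projection into the
  operator applied to the sequence.\<close>

lemma bounded_ops_scaleC:
  assumes "normed_space V" "U \<in> bounded_ops Y V"
  shows "(\<lambda>y. c *\<^sub>C U y) \<in> bounded_ops Y V"
proof -
  obtain C where C: "\<And>x. x \<in> carr Y \<Longrightarrow> nrm V (U x) \<le> C * nrm Y x"
    using assms(2) unfolding bounded_ops_def by blast
  have "nrm V (c *\<^sub>C U x) \<le> (cmod c * C) * nrm Y x" if "x \<in> carr Y" for x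
    using mult_left_mono[OF C[OF that], of "cmod c"]
    by (simp add: normed_spaceD(5)[OF assms(1)] bounded_opsD(1)[OF assms(2) that] mult.assoc)
  then have "\<exists>C. \<forall>x\<in>carr Y. nrm V (c *\<^sub>C U x) \<le> C * nrm Y x" by blast
  then show ?thesis
    using bounded_opsD[OF assms(2)] normed_space_carr(4)[OF assms(1)] unfolding bounded_ops_def
    by (auto simp: scaleC_add_right scaleC_scaleC ac_simps)
qed

section \<open>Complete subspaces of finite codimension are ranges of bounded projections\<close>

section \<open>Projections onto subspaces of finite codimension\<close>

text \<open>Completeness of \<open>X\<close> takes the role of closedness: if the distance from
  \<open>v\<close> to \<open>X\<close> were 0, points of \<open>X\<close> converging to
  \<open>v\<close> would form a Cauchy sequence, whose limit in \<open>X\<close> would have to be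
  \<open>v\<close>.\<close>

lemma complete_subspace_dist_pos:
  assumes Z: "normed_space Z" and X: "banach_space X" and XZ: "normed_subspace X Z"
    and v: "v \<in> carr Z" "v \<notin> carr X"
  obtains d where "d > 0" "\<And>x. x \<in> carr X \<Longrightarrow> d \<le> nrm Z (v - x)"
proof (rule ccontr)
  assume "\<not> thesis"
  with that have "\<exists>x\<in>carr X. nrm Z (v - x) < e" if "e > 0" for e
    using \<open>e > 0\<close> by (meson not_le)
  then have "\<forall>n::nat. \<exists>x. x \<in> carr X \<and> nrm Z (v - x) < 1 / real (Suc n)"
    by (meson of_nat_0_less_iff zero_less_Suc zero_less_divide_1_iff)
  then obtain s where s: "\<And>n. s n \<in> carr X" "\<And>n. nrm Z (v - s n) < 1 / real (Suc n)"
    by metis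
  have nX: "normed_space X" using X by (simp add: banach_space_def)
  have sub: "x \<in> carr X \<Longrightarrow> x \<in> carr Z" and eq: "x \<in> carr X \<Longrightarrow> nrm X x = nrm Z x" for x
    using XZ by (auto simp: normed_subspace_def)
  have lim: "(\<lambda>n. nrm Z (v - s n)) \<longlonglongrightarrow> 0"
  proof (rule real_tendsto_sandwich[OF _ _ tendsto_const LIMSEQ_Suc[OF lim_1_over_n]])
    show "\<forall>\<^sub>F n in sequentially. 0 \<le> nrm Z (v - s n)"
      by (simp add: normed_spaceD(2)[OF Z] normed_space_carr(3)[OF Z] v s sub)
    show "\<forall>\<^sub>F n in sequentially. nrm Z (v - s n) \<le> 1 / real (Suc n)"
      using s(2) by (simp add: less_imp_le)
  qed
  have "norm_Cauchy X s" unfolding norm_Cauchy_def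
  proof (intro allI impI)
    fix e :: real assume "e > 0"
    then have "\<forall>\<^sub>F n in sequentially. nrm Z (v - s n) < e / 2"
      using order_tendstoD(2)[OF lim, of "e/2"] by simp
    then obtain M where M: "\<And>n. n \<ge> M \<Longrightarrow> nrm Z (v - s n) < e / 2"
      by (auto simp: eventually_sequentially)
    have "nrm X (s m - s n) < e" if "m \<ge> M" "n \<ge> M" for m n
    proof -
      have "nrm X (s m - s n) = nrm Z (s m - s n)"
        using normed_space_carr(3)[OF nX s(1) s(1)] eq by blast
      also have "\<dots> \<le> nrm Z (s m - v) + nrm Z (v - s n)"
        by (rule nrm_diff_triangle[OF Z sub[OF s(1)] v(1) sub[OF s(1)]])
      also have "\<dots> = nrm Z (v - s m) + nrm Z (v - s n)"
        by (simp add: nrm_minus_commute[OF Z sub[OF s(1)] v(1)])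
      also have "\<dots> < e" using M[OF that(1)] M[OF that(2)] by simp
      finally show ?thesis .
    qed
    then show "\<exists>M. \<forall>m\<ge>M. \<forall>n\<ge>M. nrm X (s m - s n) < e" by blast
  qed
  then obtain l where l: "l \<in> carr X" "(\<lambda>n. nrm X (s n - l)) \<longlonglongrightarrow> 0"
    using X s(1) unfolding banach_space_def norm_limit_def by blast
  have "nrm Z (v - l) \<le> nrm Z (v - s n) + nrm X (s n - l)" for n
    using nrm_diff_triangle[OF Z v(1) sub[OF s(1)] sub[OF l(1)]]
      eq[OF normed_space_carr(3)[OF nX s(1) l(1)]] by simp
  then have "nrm Z (v - l) \<le> 0"
    using tendsto_add[OF lim l(2)] by (auto intro!: LIMSEQ_le_const)
  then have "v - l = 0"
    using normed_spaceD(2,3)[OF Z normed_space_carr(3)[OF Z v(1) sub[OF l(1)]]] by simp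
  with v l show False by simp
qed

text \<open>\<open>W\<close> is the sum of \<open>X\<close> and the line through \<open>v\<close>,
  and \<open>P\<close> subtracts the \<open>v\<close>-component. The coordinate along
  \<open>v\<close> is a bounded functional because \<open>v\<close> has positive distance
  \<open>d\<close> from \<open>X\<close>; this bounds \<open>P\<close> and also makes
  \<open>W\<close> complete, so the construction can be repeated with \<open>W\<close> in place of
  \<open>X\<close>.\<close>

lemma one_dim_extension_projection:
  assumes Z: "normed_space Z" and X: "banach_space X" and XZ: "normed_subspace X Z"
    and v: "v \<in> carr Z" "v \<notin> carr X"
  obtains W P where "banach_space W" "normed_subspace W Z" "carr X \<subseteq> carr W"
    "\<And>u c. u - c *\<^sub>C v \<in> carr X \<Longrightarrow> u \<in> carr W"
    "P \<in> bounded_ops W X" "\<And>x. x \<in> carr X \<Longrightarrow> P x = x"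
proof -
  have nX: "normed_space X" using X by (simp add: banach_space_def)
  note Xc = normed_space_carr[OF nX] and Zc = normed_space_carr[OF Z]
  have sub: "x \<in> carr X \<Longrightarrow> x \<in> carr Z" and eq: "x \<in> carr X \<Longrightarrow> nrm X x = nrm Z x" for x
    using XZ by (auto simp: normed_subspace_def)
  obtain d where d: "d > 0" "\<And>x. x \<in> carr X \<Longrightarrow> d \<le> nrm Z (v - x)"
    using complete_subspace_dist_pos[OF assms] by blast
  define W where "W = \<lparr>carr = {u. \<exists>c. u - c *\<^sub>C v \<in> carr X}, nrm = nrm Z\<rparr>"
  \<comment> \<open>Two different coefficients would put a nonzero multiple of \<open>v\<close>,
    hence \<open>v\<close> itself, into \<open>X\<close>. So the coordinate \<open>k u\<close> is
    well defined on \<open>W\<close>.\<close>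
  have uniq: "c = c'" if "u - c *\<^sub>C v \<in> carr X" "u - c' *\<^sub>C v \<in> carr X" for u c c'
  proof (rule ccontr)
    assume "c \<noteq> c'"
    have "(u - c' *\<^sub>C v) - (u - c *\<^sub>C v) = (c - c') *\<^sub>C v"
      by (simp add: cvec.scale_left_diff_distrib)
    with Xc(3)[OF that(2,1)] have "(c - c') *\<^sub>C v \<in> carr X" by simp
    from Xc(4)[OF this, of "1 / (c - c')"] \<open>c \<noteq> c'\<close> v(2) show False
      by (simp add: scaleC_scaleC scaleC_one)
  qed
  define k where "k u = (THE c. u - c *\<^sub>C v \<in> carr X)" for u
  have k_eq: "k u = c" if "u - c *\<^sub>C v \<in> carr X" for u c
    unfolding k_def using that uniq by blast
  define P where "P u = u - k u *\<^sub>C v" for u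
  have P_in: "P u \<in> carr X" if "u \<in> carr W" for u
    using that k_eq unfolding P_def W_def by auto
  have WZ: "u \<in> carr Z" if "u \<in> carr W" for u
    using Zc(2)[OF sub[OF P_in[OF that]] Zc(4)[OF v(1), of "k u"]] by (simp add: P_def)
  have P_add: "k (u + w) = k u + k w \<and> u + w \<in> carr W" if "u \<in> carr W" "w \<in> carr W" for u w
  proof -
    have "(u + w) - (k u + k w) *\<^sub>C v \<in> carr X"
      using Xc(2)[OF P_in[OF that(1)] P_in[OF that(2)]]
      by (simp add: P_def scaleC_add_left algebra_simps)
    then show ?thesis using k_eq by (auto simp: W_def)
  qed
  have P_scale: "k (c *\<^sub>C u) = c * k u \<and> c *\<^sub>C u \<in> carr W" if "u \<in> carr W" for u c
  proof -
    have "c *\<^sub>C u - (c * k u) *\<^sub>C v \<in> carr X"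
      using Xc(4)[OF P_in[OF that], of c]
      by (simp add: P_def cvec.scale_right_diff_distrib scaleC_scaleC)
    then show ?thesis using k_eq by (auto simp: W_def)
  qed
  have XW: "x \<in> carr W" and kX: "k x = 0" if "x \<in> carr X" for x
  proof -
    \<comment> \<open>The coefficient 0 is kept explicit, and its simplification switched off below,
      so that \<open>k_eq\<close> and the definition of \<open>W\<close> match with
      \<open>c = 0\<close>.\<close>
    have "x - 0 *\<^sub>C v \<in> carr X" using that by simp
    then show "x \<in> carr W" "k x = 0" using k_eq unfolding W_def
      by (auto simp del: cvec.scale_zero_left)
  qed
  have k_bound: "cmod (k u) \<le> nrm Z u / d" if "u \<in> carr W" for u
  proof (cases "k u = 0")
    case True
    then show ?thesis using d(1) normed_spaceD(2)[OF Z WZ[OF that]] by simp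
  next
    case False
    \<comment> \<open>Factoring \<open>k u\<close> out of \<open>u = P u + k u *\<^sub>C v\<close>
      leaves \<open>v\<close> minus a point \<open>?x\<close> of \<open>X\<close>, a vector of norm
      at least \<open>d\<close>.\<close>
    let ?x = "(- 1 / k u) *\<^sub>C P u"
    have "u = k u *\<^sub>C (v - ?x)"
      using False
      by (simp add: cvec.scale_right_diff_distrib scaleC_scaleC P_def scaleC_one cvec.scale_minus_left)
    then have "nrm Z u = cmod (k u) * nrm Z (v - ?x)"
      using normed_spaceD(5)[OF Z Zc(3)[OF v(1) sub[OF Xc(4)[OF P_in[OF that]]]]] by metis
    also have "\<dots> \<ge> cmod (k u) * d"
      by (intro mult_left_mono d(2) Xc(4) P_in that) simp
    finally show ?thesis using d(1) by (simp add: field_simps)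
  qed
  \<comment> \<open>The constant comes from the triangle inequality for
    \<open>u - k u *\<^sub>C v\<close>, with \<open>k_bound\<close> applied to the second
    term.\<close>
  define K where "K = 1 + nrm Z v / d"
  have P_bound: "nrm X (P u) \<le> K * nrm Z u" if "u \<in> carr W" for u
  proof -
    have "nrm X (P u) = nrm Z (u - k u *\<^sub>C v)" using eq[OF P_in[OF that]] by (simp add: P_def)
    also have "\<dots> \<le> nrm Z u + nrm Z (k u *\<^sub>C v)"
      by (rule nrm_diff_le[OF Z WZ[OF that] Zc(4)[OF v(1)]])
    also have "\<dots> = nrm Z u + cmod (k u) * nrm Z v" by (simp add: normed_spaceD(5)[OF Z v(1)])
    also have "\<dots> \<le> nrm Z u + nrm Z u / d * nrm Z v"
      by (intro add_left_mono mult_right_mono k_bound that normed_spaceD(2)[OF Z v(1)])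
    also have "\<dots> = K * nrm Z u" by (simp add: K_def algebra_simps)
    finally show ?thesis .
  qed
  have W_sub: "normed_subspace W Z" using WZ by (auto simp: normed_subspace_def W_def)
  have nW: "normed_space W"
  proof (rule normed_space_subspace[OF Z W_sub])
    show "cvec.subspace (carr W)"
      unfolding cvec.subspace_def using P_add P_scale XW[OF Xc(1)] by blast
  qed
  have P_op: "P \<in> bounded_ops W X"
    unfolding bounded_ops_def
  proof (intro CollectI conjI ballI allI)
    show "\<exists>C. \<forall>x\<in>carr W. nrm X (P x) \<le> C * nrm W x"
      using P_bound by (auto simp: W_def)
  qed (use P_in P_add P_scale in
      \<open>auto simp: P_def scaleC_add_left cvec.scale_right_diff_distrib scaleC_scaleC\<close>)
  \<comment> \<open>Completeness of \<open>W\<close> is checked by components: both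
    \<open>k (s n)\<close> and \<open>P (s n)\<close> are Cauchy by the two bounds. Their limits
    \<open>c\<close> and \<open>l\<close> are recombined to
    \<open>l + c *\<^sub>C v\<close>.\<close>
  have "\<exists>l. norm_limit W s l" if s: "\<And>n. s n \<in> carr W" and C: "norm_Cauchy W s" for s
  proof -
    have diffW: "s m - s n \<in> carr W" for m n using normed_space_carr(3)[OF nW s s] .
    have k_diff: "k (s m - s n) = k (s m) - k (s n)" for m n
      using P_add[OF diffW[of m n] s[of n]] by simp
    have P_diff: "P (s m - s n) = P (s m) - P (s n)" for m n
      by (simp add: P_def k_diff cvec.scale_left_diff_distrib)
    \<comment> \<open>The Cauchy condition with a constant factor, used for both bounds. Dividing by
      \<open>c + 1\<close> instead of \<open>c\<close> includes the case
      \<open>c = 0\<close>.\<close>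
    have small: "\<exists>M. \<forall>m\<ge>M. \<forall>n\<ge>M. c * nrm Z (s m - s n) < e" if "c \<ge> 0" "e > 0" for c e :: real
    proof -
      have "e / (c + 1) > 0" using that by simp
      then obtain M where M: "\<And>m n. m \<ge> M \<Longrightarrow> n \<ge> M \<Longrightarrow> nrm Z (s m - s n) < e / (c + 1)"
        using C unfolding norm_Cauchy_def W_def by (auto; meson)
      have "c * nrm Z (s m - s n) < e" if "m \<ge> M" "n \<ge> M" for m n
      proof -
        have "c * nrm Z (s m - s n) \<le> c * (e / (c + 1))"
          using M[OF that] \<open>c \<ge> 0\<close> by (intro mult_left_mono) auto
        also have "\<dots> < e" using \<open>c \<ge> 0\<close> \<open>e > 0\<close> by (simp add: field_simps)
        finally show ?thesis .
      qed
      then show ?thesis by blast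
    qed
    have "Cauchy (\<lambda>n. k (s n))"
    proof (rule CauchyI)
      fix e :: real assume "e > 0"
      then obtain M where M: "\<forall>m\<ge>M. \<forall>n\<ge>M. (1 / d) * nrm Z (s m - s n) < e"
        using small[of "1 / d" e] d(1) by auto
      have "cmod (k (s m) - k (s n)) < e" if "m \<ge> M" "n \<ge> M" for m n
        using order.strict_trans1[OF k_bound[OF diffW[of m n]], of e] M that
        by (simp add: k_diff)
      then show "\<exists>M. \<forall>m\<ge>M. \<forall>n\<ge>M. norm (k (s m) - k (s n)) < e" by blast
    qed
    then obtain c where c: "(\<lambda>n. k (s n)) \<longlonglongrightarrow> c"
      using Cauchy_convergent convergent_def by blast
    have "norm_Cauchy X (\<lambda>n. P (s n))"
      unfolding norm_Cauchy_def
    proof (intro allI impI)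
      fix e :: real assume "e > 0"
      have "K \<ge> 0" using d(1) normed_spaceD(2)[OF Z v(1)] by (simp add: K_def)
      with \<open>e > 0\<close> obtain M where M: "\<forall>m\<ge>M. \<forall>n\<ge>M. K * nrm Z (s m - s n) < e"
        using small[of K e] by blast
      have "nrm X (P (s m) - P (s n)) < e" if "m \<ge> M" "n \<ge> M" for m n
        using order.strict_trans1[OF P_bound[OF diffW[of m n]], of e] M that by (simp add: P_diff)
      then show "\<exists>M. \<forall>m\<ge>M. \<forall>n\<ge>M. nrm X (P (s m) - P (s n)) < e" by blast
    qed
    then have "\<exists>l. norm_limit X (\<lambda>n. P (s n)) l"
      using X P_in[OF s] by (simp add: banach_space_def)
    then obtain l where l: "l \<in> carr X" "(\<lambda>n. nrm X (P (s n) - l)) \<longlonglongrightarrow> 0"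
      by (auto simp: norm_limit_def)
    define w where "w = l + c *\<^sub>C v"
    have "w - c *\<^sub>C v \<in> carr X" using l(1) by (simp add: w_def)
    then have wW: "w \<in> carr W" unfolding W_def by auto
    have upper: "nrm W (s n - w) \<le> nrm X (P (s n) - l) + cmod (k (s n) - c) * nrm Z v" for n
    proof -
      have "nrm W (s n - w) = nrm Z ((P (s n) - l) + (k (s n) - c) *\<^sub>C v)"
        by (simp add: W_def w_def P_def cvec.scale_left_diff_distrib algebra_simps)
      also have "\<dots> \<le> nrm Z (P (s n) - l) + nrm Z ((k (s n) - c) *\<^sub>C v)"
        by (intro normed_spaceD(4)[OF Z] sub Xc(3) P_in s l(1) Zc(4) v(1))
      also have "\<dots> = nrm X (P (s n) - l) + cmod (k (s n) - c) * nrm Z v"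
        by (simp add: normed_spaceD(5)[OF Z v(1)] eq[OF Xc(3)[OF P_in[OF s] l(1)]])
      finally show ?thesis .
    qed
    have "(\<lambda>n. nrm X (P (s n) - l) + cmod (k (s n) - c) * nrm Z v) \<longlonglongrightarrow> 0 + cmod (c - c) * nrm Z v"
      by (intro tendsto_intros l(2) c)
    then have lim: "(\<lambda>n. nrm X (P (s n) - l) + cmod (k (s n) - c) * nrm Z v) \<longlonglongrightarrow> 0" by simp
    have "(\<lambda>n. nrm W (s n - w)) \<longlonglongrightarrow> 0"
    proof (rule real_tendsto_sandwich[OF _ _ tendsto_const lim])
      show "\<forall>\<^sub>F n in sequentially. 0 \<le> nrm W (s n - w)"
        using normed_spaceD(2)[OF nW normed_space_carr(3)[OF nW s wW]] by simp
    qed (simp add: upper)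
    with wW show ?thesis unfolding norm_limit_def by blast
  qed
  then have "banach_space W" using nW unfolding banach_space_def by blast
  then show ?thesis
  proof (rule that[OF _ W_sub _ _ P_op])
    show "carr X \<subseteq> carr W" using XW by blast
    show "u \<in> carr W" if "u - c *\<^sub>C v \<in> carr X" for u c using that by (auto simp: W_def)
    show "P x = x" if "x \<in> carr X" for x using kX[OF that] by (simp add: P_def)
  qed
qed

text \<open>Induction on the spanning set, with \<open>X\<close> left arbitrary because it grows. A
  vector \<open>g\<close> outside \<open>X\<close> is adjoined to give \<open>W\<close>; the
  remaining vectors span \<open>Z\<close> modulo \<open>W\<close>, and a projection onto
  \<open>W\<close> is followed by one from \<open>W\<close> onto \<open>X\<close>.\<close>

lemma finite_span_projection:
  assumes "finite F" "F \<subseteq> carr Z" and Z: "normed_space Z"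
    and "banach_space X" "normed_subspace X Z"
    and "\<And>z. z \<in> carr Z \<Longrightarrow> \<exists>c. z - (\<Sum>f\<in>F. c f *\<^sub>C f) \<in> carr X"
  shows "\<exists>P\<in>bounded_ops Z X. \<forall>x\<in>carr X. P x = x"
  using assms(1,2,4-)
proof (induction F arbitrary: X rule: finite_induct)
  case empty
  \<comment> \<open>An empty spanning set means that \<open>Z\<close> is contained in
    \<open>X\<close>, so the identity is the projection.\<close>
  have "z \<in> carr X" if "z \<in> carr Z" for z using empty.prems(4)[OF that] by simp
  then have "(\<lambda>x. x) \<in> bounded_ops Z X"
    using empty.prems(3) unfolding bounded_ops_def normed_subspace_def
    by (auto intro!: exI[of _ 1])
  then show ?case by (intro bexI[of _ "\<lambda>x. x"]) auto
next
  case (insert g F)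
  have nX: "normed_space X" using insert.prems(2) by (simp add: banach_space_def)
  have dec: "\<exists>c b. z - (\<Sum>f\<in>F. c f *\<^sub>C f) - b *\<^sub>C g \<in> carr X" if z: "z \<in> carr Z" for z
  proof -
    obtain c where "z - (\<Sum>f\<in>insert g F. c f *\<^sub>C f) \<in> carr X" using insert.prems(4)[OF z] by blast
    then show ?thesis
      using insert.hyps by (intro exI[of _ c] exI[of _ "c g"]) (simp add: algebra_simps)
  qed
  show ?case
  proof (cases "g \<in> carr X")
    case True
    \<comment> \<open>Here the \<open>g\<close>-term lies in \<open>X\<close> and can be added back,
      so \<open>F\<close> alone already spans modulo \<open>X\<close>.\<close>
    have "\<exists>c. z - (\<Sum>f\<in>F. c f *\<^sub>C f) \<in> carr X" if "z \<in> carr Z" for z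
    proof -
      obtain c b where "z - (\<Sum>f\<in>F. c f *\<^sub>C f) - b *\<^sub>C g \<in> carr X" using dec[OF \<open>z \<in> carr Z\<close>] by blast
      from normed_space_carr(2)[OF nX this normed_space_carr(4)[OF nX True, of b]]
      show ?thesis by auto
    qed
    then show ?thesis using insert.IH insert.prems by blast
  next
    case False
    have g: "g \<in> carr Z" using insert.prems(1) by simp
    obtain W P where W: "banach_space W" "normed_subspace W Z" "carr X \<subseteq> carr W"
      "\<And>u c. u - c *\<^sub>C g \<in> carr X \<Longrightarrow> u \<in> carr W"
      and P: "P \<in> bounded_ops W X" "\<And>x. x \<in> carr X \<Longrightarrow> P x = x"
      by (rule one_dim_extension_projection[OF Z insert.prems(2,3) g False]) blast
    \<comment> \<open>The \<open>g\<close>-term left over modulo \<open>X\<close> is absorbed by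
      \<open>W\<close>, so the induction hypothesis applies to \<open>W\<close> and
      \<open>F\<close>.\<close>
    have "\<exists>c. z - (\<Sum>f\<in>F. c f *\<^sub>C f) \<in> carr W" if "z \<in> carr Z" for z
      using dec[OF that] W(4) by blast
    then have "\<exists>Q\<in>bounded_ops Z W. \<forall>x\<in>carr W. Q x = x"
      using insert.prems(1) W(1,2) by (intro insert.IH) auto
    then obtain Q where Q: "Q \<in> bounded_ops Z W" "\<And>x. x \<in> carr W \<Longrightarrow> Q x = x"
      by blast
    have "normed_space W" using W(1) by (simp add: banach_space_def)
    then have "(\<lambda>z. P (Q z)) \<in> bounded_ops Z X" by (rule bounded_ops_comp[OF Z _ Q(1) P(1)])
    then show ?thesis
      using Q(2) P(2) W(3) by (intro bexI[of _ "\<lambda>z. P (Q z)"]) auto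
  qed
qed

lemma finite_dim_quot_projection:
  assumes "normed_space Z" "banach_space X" "normed_subspace X Z" "finite_dim_quot Z X"
  obtains P where "P \<in> bounded_ops Z X" "\<And>x. x \<in> carr X \<Longrightarrow> P x = x"
proof -
  obtain F where F: "finite F" "F \<subseteq> carr Z"
    "\<And>Q. Q \<in> quot_space Z X \<Longrightarrow> \<exists>c. Q = quot_coset X (\<Sum>f\<in>F. c f *\<^sub>C f)"
    using assms(4) unfolding finite_dim_quot_def by blast
  have zero: "0 \<in> carr X" using assms(2) normed_space_carr(1) by (auto simp: banach_space_def)
  have "\<exists>c. z - (\<Sum>f\<in>F. c f *\<^sub>C f) \<in> carr X" if z: "z \<in> carr Z" for z
  proof -
    obtain c where c: "quot_coset X z = quot_coset X (\<Sum>f\<in>F. c f *\<^sub>C f)"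
      using F(3) z unfolding quot_space_def by blast
    \<comment> \<open>Since 0 is in \<open>X\<close>, \<open>z\<close> lies in its own coset;
      reading the equality of cosets at \<open>z\<close> puts the difference from the linear
      combination into \<open>X\<close>.\<close>
    have "z \<in> quot_coset X z" using zero by (force simp: quot_coset_def)
    then obtain x where "x \<in> carr X" "z = (\<Sum>f\<in>F. c f *\<^sub>C f) + x"
      unfolding c by (auto simp: quot_coset_def)
    then show ?thesis by (intro exI[of _ c]) simp
  qed
  then show ?thesis using finite_span_projection[OF F(1,2) assms(1,2,3)] that by blast
qed

section \<open>Stability of p-compactness and weak p-compactness under composition\<close>

section \<open>Ideal properties\<close>

lemma lp_strong_image:
  assumes "1 \<le> p" "normed_space Y" "normed_space V" "U \<in> bounded_ops Y V" "y \<in> lp_strong p Y"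
  shows "(\<lambda>n. U (y n)) \<in> lp_strong p V"
proof -
  obtain C where C: "C > 0" "\<And>x. x \<in> carr Y \<Longrightarrow> nrm V (U x) \<le> C * nrm Y x"
    using bounded_ops_bound[OF assms(2,4)] by blast
  have y: "y n \<in> carr Y" for n using assms(5) by (simp add: lp_strong_def)
  have V: "U (y n) \<in> carr V" for n by (rule bounded_opsD(1)[OF assms(4) y])
  have nonneg: "0 \<le> nrm V (U (y n))" for n by (rule normed_spaceD(2)[OF assms(3) V])
  show ?thesis
  proof (cases "p = \<infinity>")
    case True
    then have "(\<lambda>n. C * nrm Y (y n)) \<longlonglongrightarrow> C * 0"
      using assms(5) by (intro tendsto_intros) (simp add: lp_strong_def)
    then have lim: "(\<lambda>n. C * nrm Y (y n)) \<longlonglongrightarrow> 0" by simp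
    have "(\<lambda>n. nrm V (U (y n))) \<longlonglongrightarrow> 0"
      by (rule real_tendsto_sandwich[OF _ _ tendsto_const lim]) (simp_all add: nonneg C(2) y)
    then show ?thesis using V True by (simp add: lp_strong_def)
  next
    case False
    let ?r = "real_of_ereal p"
    have r: "0 \<le> ?r" using assms(1) by (cases p) auto
    have "summable (\<lambda>n. C powr ?r * nrm Y (y n) powr ?r)"
      using assms(5) False by (intro summable_mult) (simp add: lp_strong_def)
    then have "summable (\<lambda>n. nrm V (U (y n)) powr ?r)"
    proof (rule summable_comparison_test'[where N = 0])
      fix n
      have "nrm V (U (y n)) powr ?r \<le> (C * nrm Y (y n)) powr ?r"
        by (intro powr_mono2 r nonneg C(2) y)
      also have "\<dots> = C powr ?r * nrm Y (y n) powr ?r"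
        using C(1) normed_spaceD(2)[OF assms(2) y] by (simp add: powr_mult)
      finally show "norm (nrm V (U (y n)) powr ?r) \<le> C powr ?r * nrm Y (y n) powr ?r" by simp
    qed
    then show ?thesis using V False by (simp add: lp_strong_def)
  qed
qed

text \<open>A functional \<open>f\<close> on \<open>V\<close> pulls back along \<open>U\<close> to a
  functional on \<open>Y\<close>, so testing the image sequence with \<open>f\<close> amounts to
  testing \<open>y\<close> with the pullback.\<close>

lemma lp_weak_image:
  assumes "normed_space Y" "normed_space V" "U \<in> bounded_ops Y V" "y \<in> lp_weak p Y"
  shows "(\<lambda>n. U (y n)) \<in> lp_weak p V"
proof -
  have "(\<lambda>x. f (U x)) \<in> dual Y" if "f \<in> dual V" for f
    using bounded_ops_comp[OF assms(1,2,3)] that by (simp add: dual_def)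
  then show ?thesis
    using assms(4) bounded_opsD(1)[OF assms(3)] unfolding lp_weak_def by auto
qed

text \<open>\<open>U\<close> carries partial sums to partial sums with the same coefficients, and
  boundedness preserves their norm limit.\<close>

lemma E_rel_image:
  assumes Y: "normed_space Y" and V: "normed_space V" and U: "U \<in> bounded_ops Y V"
    and y: "\<And>n. y n \<in> carr Y" and E: "E_rel Y y a v"
  shows "E_rel V (\<lambda>n. U (y n)) a (U v)"
proof -
  obtain C where C: "C > 0" "\<And>x. x \<in> carr Y \<Longrightarrow> nrm V (U x) \<le> C * nrm Y x"
    using bounded_ops_bound[OF Y U] by blast
  let ?s = "\<lambda>N. \<Sum>n<N. a n *\<^sub>C y n"
  have v: "v \<in> carr Y" and lim: "(\<lambda>N. nrm Y (?s N - v)) \<longlonglongrightarrow> 0"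
    using E by (auto simp: E_rel_def norm_limit_def)
  \<comment> \<open>Linearity of \<open>U\<close> is available only on the carrier, so the partial
    sums must be seen to stay there.\<close>
  have s: "?s N \<in> carr Y" for N
    by (induction N) (simp_all add: normed_space_carr[OF Y] y)
  have diff: "U (x - z) = U x - U z" if "x \<in> carr Y" "z \<in> carr Y" for x z
    using bounded_opsD(2)[OF U normed_space_carr(3)[OF Y that] that(2)] by (simp add: algebra_simps)
  have "U 0 = 0" using bounded_opsD(3)[OF U v, of 0] by simp
  then have Us: "U (?s N) = (\<Sum>n<N. a n *\<^sub>C U (y n))" for N
    by (induction N) (simp_all add: bounded_opsD(2,3)[OF U] normed_space_carr(4)[OF Y] s y)
  have "(\<lambda>N. C * nrm Y (?s N - v)) \<longlonglongrightarrow> C * 0" by (intro tendsto_intros lim)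
  then have lim': "(\<lambda>N. C * nrm Y (?s N - v)) \<longlonglongrightarrow> 0" by simp
  have "(\<lambda>N. nrm V (U (?s N - v))) \<longlonglongrightarrow> 0"
  proof (rule real_tendsto_sandwich[OF _ _ tendsto_const lim'])
    have "?s N - v \<in> carr Y" for N by (rule normed_space_carr(3)[OF Y s v])
    then show "\<forall>\<^sub>F N in sequentially. 0 \<le> nrm V (U (?s N - v))"
      "\<forall>\<^sub>F N in sequentially. nrm V (U (?s N - v)) \<le> C * nrm Y (?s N - v)"
      using normed_spaceD(2)[OF V bounded_opsD(1)[OF U]] C(2) by simp_all
  qed
  then show ?thesis
    using bounded_opsD(1)[OF U v] by (simp add: E_rel_def norm_limit_def diff[OF s v] Us)
qed

text \<open>\<open>P\<close> maps the unit ball of \<open>Z\<close> into \<open>C\<close> times that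
  of \<open>X\<close>. The coefficient set \<open>A\<close> is kept fixed, so the factor
  \<open>C\<close> is moved into the sequence through \<open>R\<close>, which is \<open>C\<close>
  times \<open>U\<close>.\<close>

lemma E_image_comp:
  assumes Z: "normed_space Z" and X: "normed_space X" and Y: "normed_space Y"
    and V: "normed_space V" and P: "P \<in> bounded_ops Z X" and T: "T \<in> bounded_ops X Y"
    and U: "U \<in> bounded_ops Y V" and y: "\<And>n. y n \<in> carr Y"
    and E: "T ` closed_unit_ball X \<subseteq> E_image Y y A"
  obtains R where "R \<in> bounded_ops Y V"
    "(\<lambda>z. U (T (P z))) ` closed_unit_ball Z \<subseteq> E_image V (\<lambda>n. R (y n)) A"
proof -
  obtain C where C: "C > 0" "\<And>z. z \<in> carr Z \<Longrightarrow> nrm X (P z) \<le> C * nrm Z z"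
    using bounded_ops_bound[OF Z P] by blast
  define R where "R w = complex_of_real C *\<^sub>C U w" for w
  have R: "R \<in> bounded_ops Y V" using bounded_ops_scaleC[OF V U] by (simp add: R_def[abs_def])
  have "U (T (P z)) \<in> E_image V (\<lambda>n. R (y n)) A" if z: "z \<in> closed_unit_ball Z" for z
  proof -
    have zZ: "z \<in> carr Z" and z1: "nrm Z z \<le> 1" using z by (auto simp: closed_unit_ball_def)
    have Pz: "P z \<in> carr X" by (rule bounded_opsD(1)[OF P zZ])
    \<comment> \<open>Rescaling brings \<open>P z\<close> into the unit ball of \<open>X\<close>,
      where \<open>E\<close> applies; the factor \<open>C\<close> in \<open>R\<close> undoes it
      afterwards.\<close>
    let ?x = "complex_of_real (1 / C) *\<^sub>C P z"
    have "nrm X ?x = nrm X (P z) / C"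
      using C(1) by (simp only: normed_spaceD(5)[OF X Pz] norm_of_real) simp
    also have "\<dots> \<le> nrm Z z" using C(1) C(2)[OF zZ] by (simp add: field_simps)
    finally have "?x \<in> closed_unit_ball X"
      using z1 normed_space_carr(4)[OF X Pz] by (simp add: closed_unit_ball_def)
    then have "T ?x \<in> E_image Y y A" using E by blast
    then obtain a where a: "a \<in> A" "E_rel Y y a (T ?x)" unfolding E_image_def by blast
    have "E_rel V (\<lambda>n. R (y n)) a (R (T ?x))" by (rule E_rel_image[OF Y V R y a(2)])
    also have "R (T ?x) = U (T (P z))"
      using C(1) bounded_opsD(1)[OF T Pz]
      by (simp add: R_def bounded_opsD(3)[OF T Pz] bounded_opsD(3)[OF U] scaleC_scaleC scaleC_one
          flip: of_real_mult)
    finally show ?thesis using a(1) by (auto simp: E_image_def)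
  qed
  then show ?thesis by (intro that[OF R]) blast
qed

text \<open>Both classes use the sequence \<open>R (y n)\<close> supplied by
  \<open>E_image_comp\<close>. They differ only in why this sequence stays in the strong or in the
  weak sequence space.\<close>

lemma
  assumes Z: "normed_space Z" and X: "normed_space X" and Y: "normed_space Y"
    and V: "normed_space V" and P: "P \<in> bounded_ops Z X" and U: "U \<in> bounded_ops Y V"
  shows p_compact_ops_comp: "1 \<le> p \<Longrightarrow> T \<in> p_compact_ops p X Y \<Longrightarrow>
      (\<lambda>z. U (T (P z))) \<in> p_compact_ops p Z V" (is "_ \<Longrightarrow> ?K \<Longrightarrow> _")
    and weakly_p_compact_ops_comp: "T \<in> weakly_p_compact_ops p X Y \<Longrightarrow>
      (\<lambda>z. U (T (P z))) \<in> weakly_p_compact_ops p Z V" (is "?W \<Longrightarrow> _")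
proof -
  have bdd: "(\<lambda>z. U (T (P z))) \<in> bounded_ops Z V" if "T \<in> bounded_ops X Y"
    using bounded_ops_comp[OF Z Y bounded_ops_comp[OF Z X P that] U] .
  show "(\<lambda>z. U (T (P z))) \<in> p_compact_ops p Z V" if "1 \<le> p" ?K
  proof -
    obtain y where T: "T \<in> bounded_ops X Y" and y: "y \<in> lp_strong p Y"
      and E: "T ` closed_unit_ball X \<subseteq> E_image Y y (closed_unit_ball (coeff_space p))"
      using \<open>?K\<close> unfolding p_compact_ops_def by blast
    have "y n \<in> carr Y" for n using y by (simp add: lp_strong_def)
    then obtain R where R: "R \<in> bounded_ops Y V"
      "(\<lambda>z. U (T (P z))) ` closed_unit_ball Z
        \<subseteq> E_image V (\<lambda>n. R (y n)) (closed_unit_ball (coeff_space p))"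
      using E_image_comp[OF Z X Y V P T U _ E] by blast
    then show ?thesis
      using lp_strong_image[OF \<open>1 \<le> p\<close> Y V R(1) y] bdd[OF T] unfolding p_compact_ops_def by blast
  qed
  show "(\<lambda>z. U (T (P z))) \<in> weakly_p_compact_ops p Z V" if ?W
  proof -
    obtain y where T: "T \<in> bounded_ops X Y" and y: "y \<in> lp_weak p Y"
      and E: "T ` closed_unit_ball X \<subseteq> E_image Y y (closed_unit_ball (coeff_space p))"
      using \<open>?W\<close> unfolding weakly_p_compact_ops_def by blast
    have "y n \<in> carr Y" for n using y by (simp add: lp_weak_def)
    then obtain R where R: "R \<in> bounded_ops Y V"
      "(\<lambda>z. U (T (P z))) ` closed_unit_ball Z
        \<subseteq> E_image V (\<lambda>n. R (y n)) (closed_unit_ball (coeff_space p))"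
      using E_image_comp[OF Z X Y V P T U _ E] by blast
    then show ?thesis
      using lp_weak_image[OF Y V R(1) y] bdd[OF T] unfolding weakly_p_compact_ops_def by blast
  qed
qed

section \<open>An isometric copy of \<open>Y\<close> in a product type, and the extension
  theorem\<close>

lemma banach_space_copy:
  fixes Y :: "'b::complex_vector nspace"
  assumes "banach_space Y"
  obtains V :: "('b \<times> 'd::complex_vector) nspace" and j
  where "banach_space V" "isometric_embedding j Y V"
proof -
  \<comment> \<open>The second component only pads the type and is 0 on the carrier, which is what
    makes the norm of the first component definite there.\<close>
  define V :: "('b \<times> 'd) nspace"
    where "V = \<lparr>carr = (\<lambda>y. (y, 0)) ` carr Y, nrm = (\<lambda>v. nrm Y (fst v))\<rparr>"
  have Y: "normed_space Y" using assms by (simp add: banach_space_def)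
  note Yc = normed_space_carr[OF Y]
  have carrV: "v \<in> carr V \<longleftrightarrow> fst v \<in> carr Y \<and> snd v = 0" for v
    by (cases v) (auto simp: V_def)
  have nrmV: "nrm V v = nrm Y (fst v)" for v by (simp add: V_def)
  have "normed_space V"
    unfolding normed_space_def cvec.subspace_def
    by (auto simp: carrV nrmV Yc scaleC_prod_def normed_spaceD(2-)[OF Y] prod_eq_iff)
  moreover have "\<exists>l. norm_limit V s l" if s: "\<forall>n. s n \<in> carr V" "norm_Cauchy V s" for s
  proof -
    have "norm_Cauchy Y (\<lambda>n. fst (s n))" using s(2) by (simp add: norm_Cauchy_def nrmV)
    then have "\<exists>l. norm_limit Y (\<lambda>n. fst (s n)) l"
      using assms s(1) by (simp add: banach_space_def carrV)
    then obtain l where "norm_limit Y (\<lambda>n. fst (s n)) l" ..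
    then have "norm_limit V s (l, 0)" by (simp add: norm_limit_def nrmV carrV)
    then show ?thesis ..
  qed
  ultimately have "banach_space V" unfolding banach_space_def by blast
  moreover have "isometric_embedding (\<lambda>y. (y, 0)) Y V"
    unfolding isometric_embedding_def bounded_ops_def
    by (auto simp: carrV nrmV scaleC_prod_def intro!: exI[of _ 1])
  ultimately show ?thesis by (rule that)
qed

theorem proposition2p2:
  fixes p :: ereal
    and X Z :: "'c::complex_vector nspace"
    and Y :: "'b::complex_vector nspace"
    and T :: "'c \<Rightarrow> 'b"
  assumes "1 \<le> p"
    and "banach_space X" and "banach_space Y" and "banach_space Z"
    and "normed_subspace X Z"
    and "finite_dim_quot Z X"
  shows
    "(T \<in> p_compact_ops p X Y \<longrightarrow>
       (\<exists>(V :: ('b, 'c) superspace_type nspace) j S.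
          banach_space V \<and> isometric_embedding j Y V \<and>
          S \<in> p_compact_ops p Z V \<and> extends_via S j T X)) \<and>
     (T \<in> weakly_p_compact_ops p X Y \<longrightarrow>
       (\<exists>(V :: ('b, 'c) superspace_type nspace) j S.
          banach_space V \<and> isometric_embedding j Y V \<and>
          S \<in> weakly_p_compact_ops p Z V \<and> extends_via S j T X))"
proof -
  \<comment> \<open>The padding type is \<open>'c \<times> (nat \<Rightarrow> complex)\<close>. As
    \<open>V\<close> depends only on \<open>Y\<close>, one choice serves both parts.\<close>
  obtain V :: "('b, 'c) superspace_type nspace" and j
    where V: "banach_space V" and j: "isometric_embedding j Y V"
    using banach_space_copy[OF assms(3)] by blast
  have normed: "normed_space Z" "normed_space X" "normed_space Y" "normed_space V"
    using assms(2-4) V by (simp_all add: banach_space_def)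
  obtain P where P: "P \<in> bounded_ops Z X" "\<And>x. x \<in> carr X \<Longrightarrow> P x = x"
    using finite_dim_quot_projection[OF normed(1) assms(2,5,6)] by blast
  have "j \<in> bounded_ops Y V" using j by (simp add: isometric_embedding_def)
  note comp = p_compact_ops_comp[OF normed P(1) this assms(1)]
    weakly_p_compact_ops_comp[OF normed P(1) this]
  have "extends_via (\<lambda>z. j (T (P z))) j T X" by (simp add: extends_via_def P(2))
  with V j comp show ?thesis by blast
qed

end
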